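(* Let $G$ be a locally finite, connected graph. For every $k\in\mathbb N$, every separation $s\in X^k:=\bigcup\mathcal B^k(G)$ crosses only finitely many separations in $X^k$, so that the function $x^k$ and the sets $N^k(G,\beta)$, $N^k(G)$, $N^{<k}(G)$ and $N(G)$ described below are well-defined. Moreover, the sets $N(G)$ and $N^{<k}(G)$ (for every $k\in\mathbb N$) are nested, and $N^k(G,\beta)$ is non-empty for every $k\in\mathbb N$ and every $k$-bottleneck $\beta$ in $G$.
   Context: Graphs are simple. A separation of $G$ is a set $\{A,B\}$ with $A\cup B=V(G)$ such that $G$ has no edge between $A\setminus B$ and $B\setminus A$; its separator is $A\cap B$ and its order is $|A\cap B|$; a $k$-separation is one of order $k$. Its orientations are the ordered pairs $(A,B),(B,A)$; $(A,B)\ge(C,D)$ means $A\subseteq C$ and $B\supseteq D$. Two separations are nested if they have $\ge$-comparable orientations, and cross otherwise; a set of separations is nested if its elements are pairwise nested. A component $K$ of $G-X$ is tight (at $X$) if $N_G(K)=X$. A separation $\{A,B\}$ is tight if $G-(A\cap B)$ has tight components whose vertex sets are contained in $A$ and in $B$, respectively. A $\top$-star is a set $\sigma=\{(A_i,B_i):i\in[3]\}$ of three distinct oriented separations with separators $X_i=A_i\cap B_i$ such that (Y1) the sets $A_i\setminus B_i$ ($i\in[3]$) are pairwise disjoint with union $V(G)\setminus\bigcup_i X_i$, and (Y2) every vertex in some $X_i$ lies in at least one other $X_j$. Its constituents are the unoriented $\{A_i,B_i\}$; it has order $\le k$ if all have order $\le k$. Its centre is $Z=\bigcap_i X_i$ and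 $X_{ij}=(X_i\cap X_j)\setminus Z$. It is relevant with base $\{A_1,B_1\}$ if $\{A_1,B_1\}$ is tight and for every $x\in X_{23}$ and every $i\in\{2,3\}$ there is an edge from $x$ to $X_{1i}$, or there are $y\in X_{1i}\cup Z$ and a component $K$ of $G[A_i\setminus B_i]$ with $x,y\in N(K)$. A bottleneck of order $k$ (a $k$-bottleneck) is a non-empty set $\beta$ of tight $k$-separations of $G$ such that whenever $\beta$ contains the base of a relevant $\top$-star of order $\le k$, it contains at least one of the other two constituents of that $\top$-star. Construction: let $\mathcal B^k(G)$ be the set of all $k$-bottlenecks and $X^k=\bigcup\mathcal B^k(G)$. Let $x^k(s)$ be the number of separations in $X^k$ that $s\in X^k$ crosses. Recursively for $k\in\mathbb N$: $N^{<k}(G)=\bigcup_{j<k}N^j(G)$; for $\beta\in\mathcal B^k(G)$, $N^k(G,\beta)$ consists of those $s\in\beta$ that are nested with every element of $N^{<k}(G)$ and among these have minimal $x^k(s)$; $N^k(G)=\bigcup_{\beta\in\mathcal B^k(G)}N^k(G,\beta)$; and $N(G)=\bigcup_{k\in\mathbb N}N^k(G)$. *)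

theory Defs
  imports Main
begin

record 'a sgraph =
  vertices :: "'a set"
  edges :: "'a set set"

definition simple_graph :: "'a sgraph \<Rightarrow> bool" where
  "simple_graph G \<longleftrightarrow> (\<forall>e\<in>edges G. e \<subseteq> vertices G \<and> card e = 2)"

definition adjacent :: "'a sgraph \<Rightarrow> 'a \<Rightarrow> 'a \<Rightarrow> bool" where
  "adjacent G u v \<longleftrightarrow> {u, v} \<in> edges G"

definition neighbourhood :: "'a sgraph \<Rightarrow> 'a set \<Rightarrow> 'a set" where
  "neighbourhood G K = {v \<in> vertices G - K. \<exists>u\<in>K. adjacent G u v}"

definition locally_finite_graph :: "'a sgraph \<Rightarrow> bool" where
  "locally_finite_graph G \<longleftrightarrow> (\<forall>v\<in>vertices G. finite {e \<in> edges G. v \<in> e})"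

definition connected_graph :: "'a sgraph \<Rightarrow> bool" where
  "connected_graph G \<longleftrightarrow>
     vertices G \<noteq> {} \<and> (\<forall>u\<in>vertices G. \<forall>v\<in>vertices G. (adjacent G)\<^sup>*\<^sup>* u v)"

definition induced_subgraph :: "'a sgraph \<Rightarrow> 'a set \<Rightarrow> 'a sgraph" where
  "induced_subgraph G U =
     \<lparr>vertices = vertices G \<inter> U, edges = {e \<in> edges G. e \<subseteq> U}\<rparr>"

definition delete_vertices :: "'a sgraph \<Rightarrow> 'a set \<Rightarrow> 'a sgraph" where
  "delete_vertices G X = induced_subgraph G (vertices G - X)"

text \<open>Components are induced subgraphs and are represented by their vertex sets.\<close>

definition graph_components :: "'a sgraph \<Rightarrow> 'a set set" where
  "graph_components G =
     {K. K \<subseteq> vertices G \<and> connected_graph (induced_subgraph G K) \<and>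
         (\<forall>L. K \<subseteq> L \<and> L \<subseteq> vertices G \<and> connected_graph (induced_subgraph G L) \<longrightarrow> L = K)}"

definition tight_component :: "'a sgraph \<Rightarrow> 'a set \<Rightarrow> 'a set \<Rightarrow> bool" where
  "tight_component G X K \<longleftrightarrow>
     K \<in> graph_components (delete_vertices G X) \<and> neighbourhood G K = X"

text \<open>
  An unoriented separation is the set \<open>{A, B}\<close> of its two sides (a singleton if \<open>A = B\<close>);
  an oriented separation is one of the pairs \<open>(A, B)\<close>, \<open>(B, A)\<close>.
\<close>

type_synonym 'a separation = "'a set set"
type_synonym 'a oriented_separation = "'a set \<times> 'a set"

definition is_oriented_separation :: "'a sgraph \<Rightarrow> 'a oriented_separation \<Rightarrow> bool" where
  "is_oriented_separation G = (\<lambda>(A, B). A \<union> B = vertices G \<and>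
     \<not> (\<exists>u \<in> A - B. \<exists>v \<in> B - A. adjacent G u v))"

definition orientations :: "'a separation \<Rightarrow> 'a oriented_separation set" where
  "orientations s = {(A, B). s = {A, B}}"

definition is_separation :: "'a sgraph \<Rightarrow> 'a separation \<Rightarrow> bool" where
  "is_separation G s \<longleftrightarrow> (\<exists>A B. s = {A, B} \<and> is_oriented_separation G (A, B))"

definition separator :: "'a separation \<Rightarrow> 'a set" where
  "separator s = \<Inter> s"

definition has_order :: "'a separation \<Rightarrow> nat \<Rightarrow> bool" where
  "has_order s k \<longleftrightarrow> finite (separator s) \<and> card (separator s) = k"

definition sep_ge :: "'a oriented_separation \<Rightarrow> 'a oriented_separation \<Rightarrow> bool" where
  "sep_ge = (\<lambda>(A, B) (C, D). A \<subseteq> C \<and> B \<supseteq> D)"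

definition nested :: "'a separation \<Rightarrow> 'a separation \<Rightarrow> bool" where
  "nested s t \<longleftrightarrow>
     (\<exists>p \<in> orientations s. \<exists>q \<in> orientations t. sep_ge p q \<or> sep_ge q p)"

definition crosses :: "'a separation \<Rightarrow> 'a separation \<Rightarrow> bool" where
  "crosses s t \<longleftrightarrow> \<not> nested s t"

definition nested_set :: "'a separation set \<Rightarrow> bool" where
  "nested_set S \<longleftrightarrow> (\<forall>s\<in>S. \<forall>t\<in>S. nested s t)"

definition tight_separation :: "'a sgraph \<Rightarrow> 'a separation \<Rightarrow> bool" where
  "tight_separation G s \<longleftrightarrow> is_separation G s \<and>
     (\<forall>A\<in>s. \<exists>K. tight_component G (separator s) K \<and> K \<subseteq> A)"

text \<open>
  A \<open>\<top>\<close>-star is given by an enumeration \<open>(A i, B i)\<close>, \<open>i \<in> {1, 2, 3}\<close>, of its elements;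
  values of \<open>A\<close> and \<open>B\<close> at other indices are irrelevant. The base always carries index 1,
  which is no restriction because stars are quantified over all enumerations.
\<close>

definition star_sep :: "(nat \<Rightarrow> 'a set) \<Rightarrow> (nat \<Rightarrow> 'a set) \<Rightarrow> nat \<Rightarrow> 'a set" where
  "star_sep A B i = A i \<inter> B i"

definition star_centre :: "(nat \<Rightarrow> 'a set) \<Rightarrow> (nat \<Rightarrow> 'a set) \<Rightarrow> 'a set" where
  "star_centre A B = (\<Inter>i\<in>{1,2,3}. star_sep A B i)"

definition star_link :: "(nat \<Rightarrow> 'a set) \<Rightarrow> (nat \<Rightarrow> 'a set) \<Rightarrow> nat \<Rightarrow> nat \<Rightarrow> 'a set" where
  "star_link A B i j = (star_sep A B i \<inter> star_sep A B j) - star_centre A B"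

definition top_star :: "'a sgraph \<Rightarrow> (nat \<Rightarrow> 'a set) \<Rightarrow> (nat \<Rightarrow> 'a set) \<Rightarrow> bool" where
  "top_star G A B \<longleftrightarrow>
     (\<forall>i\<in>{1,2,3}. is_oriented_separation G (A i, B i)) \<and>
     inj_on (\<lambda>i. (A i, B i)) {1,2,3} \<and>
     (\<forall>i\<in>{1,2,3}. \<forall>j\<in>{1,2,3}. i \<noteq> j \<longrightarrow> (A i - B i) \<inter> (A j - B j) = {}) \<and>
     (\<Union>i\<in>{1,2,3}. A i - B i) = vertices G - (\<Union>i\<in>{1,2,3}. star_sep A B i) \<and>
     (\<forall>i\<in>{1,2,3}. \<forall>v \<in> star_sep A B i. \<exists>j\<in>{1,2,3}. j \<noteq> i \<and> v \<in> star_sep A B j)"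

definition star_order_le :: "(nat \<Rightarrow> 'a set) \<Rightarrow> (nat \<Rightarrow> 'a set) \<Rightarrow> nat \<Rightarrow> bool" where
  "star_order_le A B k \<longleftrightarrow> (\<forall>i\<in>{1,2,3}. \<exists>j\<le>k. has_order {A i, B i} j)"

definition relevant_top_star :: "'a sgraph \<Rightarrow> (nat \<Rightarrow> 'a set) \<Rightarrow> (nat \<Rightarrow> 'a set) \<Rightarrow> bool" where
  "relevant_top_star G A B \<longleftrightarrow> top_star G A B \<and> tight_separation G {A 1, B 1} \<and>
     (\<forall>x \<in> star_link A B 2 3. \<forall>i\<in>{2,3}.
        (\<exists>y \<in> star_link A B 1 i. adjacent G x y) \<or>
        (\<exists>y \<in> star_link A B 1 i \<union> star_centre A B.
           \<exists>K \<in> graph_components (induced_subgraph G (A i - B i)).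
             x \<in> neighbourhood G K \<and> y \<in> neighbourhood G K))"

definition bottleneck :: "'a sgraph \<Rightarrow> nat \<Rightarrow> 'a separation set \<Rightarrow> bool" where
  "bottleneck G k \<beta> \<longleftrightarrow> \<beta> \<noteq> {} \<and>
     (\<forall>s\<in>\<beta>. tight_separation G s \<and> has_order s k) \<and>
     (\<forall>A B. relevant_top_star G A B \<and> star_order_le A B k \<and> {A 1, B 1} \<in> \<beta> \<longrightarrow>
        {A 2, B 2} \<in> \<beta> \<or> {A 3, B 3} \<in> \<beta>)"

definition bottlenecks :: "'a sgraph \<Rightarrow> nat \<Rightarrow> 'a separation set set" where
  "bottlenecks G k = {\<beta>. bottleneck G k \<beta>}"

definition bottleneck_seps :: "'a sgraph \<Rightarrow> nat \<Rightarrow> 'a separation set" where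
  "bottleneck_seps G k = \<Union> (bottlenecks G k)"

text \<open>Meaningful only if the set being counted is finite, since \<open>card\<close> of an infinite set is 0.\<close>

definition crossing_number :: "'a sgraph \<Rightarrow> nat \<Rightarrow> 'a separation \<Rightarrow> nat" where
  "crossing_number G k s = card {t \<in> bottleneck_seps G k. crosses s t}"

text \<open>\<open>least_crossing G k M \<beta>\<close> is \<open>N\<^sup>k(G, \<beta>)\<close> with \<open>M\<close> in the role of \<open>N\<^sup><\<^sup>k(G)\<close>.\<close>

definition least_crossing ::
    "'a sgraph \<Rightarrow> nat \<Rightarrow> 'a separation set \<Rightarrow> 'a separation set \<Rightarrow> 'a separation set" where
  "least_crossing G k M \<beta> =
     (let C = {s \<in> \<beta>. \<forall>t\<in>M. nested s t}
      in {s \<in> C. \<forall>s'\<in>C. crossing_number G k s \<le> crossing_number G k s'})"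

fun N_level :: "'a sgraph \<Rightarrow> nat \<Rightarrow> 'a separation set" where
  "N_level G k =
     (\<Union>\<beta> \<in> bottlenecks G k. least_crossing G k (\<Union>j\<in>{..<k}. N_level G j) \<beta>)"

declare N_level.simps [simp del]

definition N_below :: "'a sgraph \<Rightarrow> nat \<Rightarrow> 'a separation set" where
  "N_below G k = (\<Union>j\<in>{..<k}. N_level G j)"

definition N_bottleneck :: "'a sgraph \<Rightarrow> nat \<Rightarrow> 'a separation set \<Rightarrow> 'a separation set" where
  "N_bottleneck G k \<beta> = least_crossing G k (N_below G k) \<beta>"

lemma N_level_eq: "N_level G k = (\<Union>\<beta> \<in> bottlenecks G k. N_bottleneck G k \<beta>)"
  unfolding N_bottleneck_def N_below_def by (rule N_level.simps)

definition N_all :: "'a sgraph \<Rightarrow> 'a separation set" where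
  "N_all G = (\<Union>k. N_level G k)"

end

theory Submission
  imports Defs
begin

text \<open>
  If tight separations \<open>{A, B}\<close> and \<open>{C, D}\<close> cross, then either their separators meet or each
  separator meets every tight component at the other. Hence \<open>C \<inter> D\<close> is a minimal separator of two
  vertices at distance at most 1 from \<open>A \<inter> B\<close>, and there are only finitely many of these of a
  given size. The same fact makes the \<open>\<top>\<close>-star consisting of \<open>(B, A)\<close> and the corners
  \<open>(A \<inter> C, B \<union> D)\<close>, \<open>(A \<inter> D, B \<union> C)\<close> relevant with base \<open>{A, B}\<close>. Orders of opposite corners add
  up to the sum of the two orders, so the stars with bases \<open>{A, B}\<close> and \<open>{C, D}\<close> put corners into
  the bottlenecks. For different orders, such a corner crosses fewer elements of
  \<open>N\<^sup><\<^sup>k(G)\<close>. For equal orders, the sum of the crossing numbers of two opposite corners is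
  strictly smaller than that of \<open>{A, B}\<close> and \<open>{C, D}\<close>, contradicting the choice of both.
\<close>

section \<open>Reachability\<close>

text \<open>Reachability by walks inside \<open>U\<close>. As a reflexive closure it holds from
  \<open>u\<close> to \<open>u\<close> even when \<open>u\<close> is outside \<open>U\<close>, so
  membership in \<open>U\<close> has to be supplied separately.\<close>

definition reach :: "'a sgraph \<Rightarrow> 'a set \<Rightarrow> 'a \<Rightarrow> 'a \<Rightarrow> bool" where
  "reach G U = (\<lambda>a b. adjacent G a b \<and> a \<in> U \<and> b \<in> U)\<^sup>*\<^sup>*"

lemma adjacent_commute: "adjacent G u v \<longleftrightarrow> adjacent G v u"
  by (simp add: adjacent_def insert_commute)

lemma adjacent_induced_subgraph:
  "adjacent (induced_subgraph G U) u v \<longleftrightarrow> adjacent G u v \<and> u \<in> U \<and> v \<in> U"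
  by (auto simp: adjacent_def induced_subgraph_def)

lemma reach_refl: "reach G U u u"
  by (simp add: reach_def)

lemma reach_step: "adjacent G u v \<Longrightarrow> u \<in> U \<Longrightarrow> v \<in> U \<Longrightarrow> reach G U u v"
  by (auto simp: reach_def)

lemma reach_trans: "reach G U u v \<Longrightarrow> reach G U v w \<Longrightarrow> reach G U u w"
  by (simp add: reach_def)

lemma reach_mono: "reach G U u v \<Longrightarrow> U \<subseteq> W \<Longrightarrow> reach G W u v"
  unfolding reach_def by (rule rtranclp_mono[THEN predicate2D, rotated]) auto

lemma reach_commute: "reach G U u v \<Longrightarrow> reach G U v u"
  unfolding reach_def
  by (rule sympD[OF symp_rtranclp]) (auto intro!: sympI simp: adjacent_commute)

lemma reach_induct [consumes 1, case_names base step]: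
  assumes "reach G U u v" "P u"
    and "\<And>y z. reach G U u y \<Longrightarrow> adjacent G y z \<Longrightarrow> y \<in> U \<Longrightarrow> z \<in> U \<Longrightarrow> P y \<Longrightarrow> P z"
  shows "P v"
  using assms(1)[unfolded reach_def]
proof (induction rule: rtranclp_induct)
  case base
  show ?case by (rule assms(2))
next
  case (step y z)
  have "reach G U u y" using step(1) by (simp add: reach_def)
  with step show ?case using assms(3)[of y z] by simp
qed

lemma reach_closed:
  assumes "reach G U u v" "u \<in> S"
    and "\<And>a b. a \<in> S \<Longrightarrow> a \<in> U \<Longrightarrow> b \<in> U \<Longrightarrow> adjacent G a b \<Longrightarrow> b \<in> S"
  shows "v \<in> S"
  using assms(1)
proof (induction rule: reach_induct)
  case base
  show ?case by (rule assms(2))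
next
  case (step y z)
  show ?case by (rule assms(3)[OF step(5,3,4,2)])
qed

text \<open>A walk visits only finitely many vertices. A set of vertices that separates
  \<open>u\<close> from \<open>v\<close> therefore meets the finite set \<open>P\<close>.\<close>

lemma reach_finite_support:
  assumes "reach G U u v"
  obtains P where "finite P" "P \<subseteq> U" "reach G P u v"
proof -
  have "\<exists>P. finite P \<and> P \<subseteq> U \<and> reach G P u v"
    using assms
  proof (induction rule: reach_induct)
    case base
    show ?case by (intro exI[of _ "{}"]) (simp add: reach_refl)
  next
    case (step y z)
    then obtain P where P: "finite P" "P \<subseteq> U" "reach G P u y" by auto
    have "reach G (insert y (insert z P)) u y"
      by (rule reach_mono[OF P(3)]) auto
    moreover have "reach G (insert y (insert z P)) y z"
      using step by (auto intro: reach_step)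
    ultimately have "reach G (insert y (insert z P)) u z"
      by (rule reach_trans)
    with P step show ?case
      by (intro exI[of _ "insert y (insert z P)"]) auto
  qed
  with that show thesis by auto
qed

section \<open>Connected vertex sets and components as reachability classes\<close>

lemma connected_induced_subgraph_iff:
  "K \<subseteq> vertices G \<Longrightarrow> connected_graph (induced_subgraph G K) \<longleftrightarrow>
     K \<noteq> {} \<and> (\<forall>u\<in>K. \<forall>v\<in>K. reach G K u v)"
proof -
  assume "K \<subseteq> vertices G"
  then have "vertices (induced_subgraph G K) = K" by (auto simp: induced_subgraph_def)
  moreover have "(adjacent (induced_subgraph G K))\<^sup>*\<^sup>* = reach G K"
    unfolding reach_def by (intro arg_cong[of _ _ rtranclp] ext) (rule adjacent_induced_subgraph)
  ultimately show ?thesis by (simp add: connected_graph_def)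
qed

lemma induced_subgraph_induced_subgraph:
  "K \<subseteq> U \<Longrightarrow> induced_subgraph (induced_subgraph G U) K = induced_subgraph G K"
  by (auto simp: induced_subgraph_def)

lemma component_containing:
  assumes "u \<in> U" "U \<subseteq> vertices G"
  shows "{v. reach G U u v} \<in> graph_components (induced_subgraph G U)"
proof -
  let ?L = "{v. reach G U u v}"
  have verts: "vertices (induced_subgraph G U) = U"
    using assms by (auto simp: induced_subgraph_def)
  have LU: "?L \<subseteq> U"
    using assms by (auto intro: reach_closed[of G U u _ U])
  \<comment> \<open>A walk in \<open>U\<close> starting at \<open>u\<close> never leaves the class
    of \<open>u\<close>, so it is also a walk in \<open>?L\<close>.\<close>
  have fwd: "reach G ?L u v" if "reach G U u v" for v
    using that
  proof (induction rule: reach_induct)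
    case base
    show ?case by (rule reach_refl)
  next
    case (step y z)
    have "reach G U u z" using step reach_trans reach_step by metis
    then have "reach G ?L y z" using step by (intro reach_step) auto
    with step.IH show ?case by (blast intro: reach_trans)
  qed
  have conn: "connected_graph (induced_subgraph (induced_subgraph G U) ?L)"
    unfolding induced_subgraph_induced_subgraph[OF LU]
    using fwd LU assms
    by (subst connected_induced_subgraph_iff)
      (auto intro: reach_refl, meson reach_commute reach_trans)
  have "M = ?L" if "?L \<subseteq> M" "M \<subseteq> U" "connected_graph (induced_subgraph (induced_subgraph G U) M)" for M
  proof -
    have "\<forall>v\<in>M. reach G M u v"
      using that assms reach_refl[of G U u]
      by (auto simp: induced_subgraph_induced_subgraph connected_induced_subgraph_iff)
    then show ?thesis using that by (auto intro: reach_mono)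
  qed
  with conn LU verts show ?thesis by (auto simp: graph_components_def)
qed

section \<open>Tight sets and separations\<close>

text \<open>Maximality of a component \<open>K\<close> of \<open>G - Y\<close> is already implied by \<open>N(K) = Y\<close>.\<close>

definition tight_set :: "'a sgraph \<Rightarrow> 'a set \<Rightarrow> 'a set \<Rightarrow> bool" where
  "tight_set G Y K \<longleftrightarrow> K \<noteq> {} \<and> K \<subseteq> vertices G - Y \<and>
     (\<forall>u\<in>K. \<forall>v\<in>K. reach G K u v) \<and> neighbourhood G K = Y"

lemma tight_component_imp_tight_set: "tight_component G Y K \<Longrightarrow> tight_set G Y K"
proof -
  assume K: "tight_component G Y K"
  then have sub: "K \<subseteq> vertices G - Y"
    by (auto simp: tight_component_def graph_components_def delete_vertices_def induced_subgraph_def)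
  then have "induced_subgraph (delete_vertices G Y) K = induced_subgraph G K"
    by (simp add: delete_vertices_def induced_subgraph_induced_subgraph)
  with K sub show ?thesis
    using connected_induced_subgraph_iff[of K G]
    by (auto simp: tight_component_def graph_components_def tight_set_def)
qed

lemma is_oriented_separation_iff:
  "is_oriented_separation G (A, B) \<longleftrightarrow>
     A \<union> B = vertices G \<and> (\<forall>u\<in>A - B. \<forall>v\<in>B - A. \<not> adjacent G u v)"
  by (auto simp: is_oriented_separation_def)

lemma is_oriented_separation_commute:
  "is_oriented_separation G (A, B) \<longleftrightarrow> is_oriented_separation G (B, A)"
  unfolding is_oriented_separation_iff by (metis Un_commute adjacent_commute)

lemma tight_separation_imp_oriented:
  "tight_separation G {A, B} \<Longrightarrow> is_oriented_separation G (A, B)"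
  unfolding tight_separation_def is_separation_def doubleton_eq_iff
  using is_oriented_separation_commute by blast

lemma separator_doubleton [simp]: "separator {A, B} = A \<inter> B"
  by (simp add: separator_def)

lemma tight_separation_tight_set:
  assumes "tight_separation G {A, B}"
  obtains K where "tight_set G (A \<inter> B) K" "K \<subseteq> A - B"
proof -
  obtain K where K: "tight_component G (A \<inter> B) K" "K \<subseteq> A"
    using assms by (auto simp: tight_separation_def)
  have t: "tight_set G (A \<inter> B) K" using K(1) by (rule tight_component_imp_tight_set)
  show thesis by (rule that[OF t]) (use t K in \<open>auto simp: tight_set_def\<close>)
qed

lemma tight_separation_commute: "tight_separation G {A, B} \<longleftrightarrow> tight_separation G {B, A}"
  by (simp add: insert_commute)

lemma separation_adjacent:
  assumes "is_oriented_separation G (A, B)" "adjacent G u v" "u \<in> A" "u \<notin> B" "v \<in> vertices G"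
  shows "v \<in> A"
  using assms by (auto simp: is_oriented_separation_iff)

lemma tight_set_avoiding_separator:
  assumes "is_oriented_separation G (A, B)" "tight_set G Y K" "K \<inter> (A \<inter> B) = {}"
    and "u \<in> K" "u \<in> A"
  shows "K \<subseteq> A - B"
proof
  fix v assume "v \<in> K"
  then have "reach G K u v" using assms by (simp add: tight_set_def)
  then show "v \<in> A - B"
  proof (rule reach_closed)
    show "u \<in> A - B" using assms by auto
  next
    fix a b assume "a \<in> A - B" "b \<in> K" "adjacent G a b"
    then show "b \<in> A - B"
      using assms separation_adjacent[OF assms(1), of a b] by (auto simp: tight_set_def)
  qed
qed

text \<open>The connected set \<open>K\<close> cannot change sides without using the separator. A
  neighbour of a vertex of \<open>A - B\<close> still lies in \<open>A\<close>, so
  \<open>Y = N(K)\<close> ends up on the same side as \<open>K\<close>.\<close>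

lemma tight_set_side:
  assumes "is_oriented_separation G (A, B)" "tight_set G Y K" "K \<inter> (A \<inter> B) = {}"
  shows "K \<subseteq> A - B \<and> Y \<subseteq> A \<or> K \<subseteq> B - A \<and> Y \<subseteq> B"
proof -
  have side: "K \<subseteq> A - B \<and> Y \<subseteq> A"
    if sep: "is_oriented_separation G (A, B)" and "K \<inter> (A \<inter> B) = {}" "u \<in> K" "u \<in> A" for A B u
  proof
    show K: "K \<subseteq> A - B"
      using tight_set_avoiding_separator[OF sep assms(2)] that by blast
    show "Y \<subseteq> A"
    proof
      fix y assume "y \<in> Y"
      then obtain w where "w \<in> K" "adjacent G w y" "y \<in> vertices G"
        using assms(2) by (auto simp: tight_set_def neighbourhood_def)
      with K show "y \<in> A" using separation_adjacent[OF sep] by blast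
    qed
  qed
  obtain u where "u \<in> K" "u \<in> A \<or> u \<in> B"
    using assms by (fastforce simp: tight_set_def is_oriented_separation_iff)
  then show ?thesis
    using side[of A B u] side[of B A u] assms by (auto simp: is_oriented_separation_commute)
qed

lemma nested_iff:
  "nested {A, B} {C, D} \<longleftrightarrow>
     (A \<subseteq> C \<and> D \<subseteq> B) \<or> (A \<subseteq> D \<and> C \<subseteq> B) \<or> (B \<subseteq> C \<and> D \<subseteq> A) \<or> (B \<subseteq> D \<and> C \<subseteq> A)"
proof -
  have "orientations {A, B} = {(A, B), (B, A)}" for A B :: "'a set"
    by (auto simp: orientations_def doubleton_eq_iff)
  then show ?thesis by (auto simp: nested_def sep_ge_def)
qed

lemma nested_commute: "nested s t \<longleftrightarrow> nested t s"
  by (auto simp: nested_def)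

section \<open>Consequences of connectedness and local finiteness\<close>

locale connected_locally_finite_graph =
  fixes G :: "'a sgraph"
  assumes simple: "simple_graph G"
    and locally_finite: "locally_finite_graph G"
    and connected: "connected_graph G"
begin

lemma adjacent_in_vertices: "adjacent G u v \<Longrightarrow> u \<in> vertices G \<and> v \<in> vertices G"
  using simple by (auto simp: simple_graph_def adjacent_def)

text \<open>Connectedness enters through this lemma: below, a non-empty set without outgoing edges
  becomes the whole graph, although some vertex is known to lie outside it.\<close>

lemma adjacency_closed_eq_vertices:
  assumes "S \<subseteq> vertices G" "u \<in> S" "\<And>a b. a \<in> S \<Longrightarrow> adjacent G a b \<Longrightarrow> b \<in> S"
  shows "S = vertices G"
proof -
  have "v \<in> S" if "v \<in> vertices G" for v
  proof -
    have "(adjacent G)\<^sup>*\<^sup>* u v"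
      using that assms connected by (auto simp: connected_graph_def)
    then show ?thesis by (induction rule: rtranclp_induct) (use assms in auto)
  qed
  with assms show ?thesis by auto
qed

lemma finite_neighbours:
  assumes "finite Y"
  shows "finite {w. \<exists>y\<in>Y. adjacent G y w}"
proof -
  have "finite {w. adjacent G y w}" for y
  proof (cases "y \<in> vertices G")
    case True
    then have "finite {e \<in> edges G. y \<in> e}"
      using locally_finite by (auto simp: locally_finite_graph_def)
    moreover have "(\<lambda>w. {y, w}) ` {w. adjacent G y w} \<subseteq> {e \<in> edges G. y \<in> e}"
      by (auto simp: adjacent_def)
    ultimately have "finite ((\<lambda>w. {y, w}) ` {w. adjacent G y w})"
      by (rule finite_subset[rotated])
    then show ?thesis
      by (rule finite_imageD) (auto simp: inj_on_def doubleton_eq_iff)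
  next
    case False
    then have "{w. adjacent G y w} = {}" using adjacent_in_vertices by auto
    then show ?thesis by simp
  qed
  moreover have "{w. \<exists>y\<in>Y. adjacent G y w} = (\<Union>y\<in>Y. {w. adjacent G y w})" by auto
  ultimately show ?thesis using assms by simp
qed

text \<open>Tight sets at an empty separator have no neighbours. One in \<open>A - B\<close> would
  be the whole graph and leave no room for one in \<open>B - A\<close>.\<close>

lemma separator_nonempty:
  assumes "tight_separation G {A, B}"
  shows "A \<inter> B \<noteq> {}"
proof
  assume empty: "A \<inter> B = {}"
  obtain K where K: "tight_set G (A \<inter> B) K" "K \<subseteq> A - B"
    using tight_separation_tight_set[OF assms] .
  obtain L where L: "tight_set G (B \<inter> A) L" "L \<subseteq> B - A"
    using tight_separation_tight_set assms tight_separation_commute by metis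
  obtain u where "u \<in> K" using K by (auto simp: tight_set_def)
  then have "K = vertices G"
    using K empty by (intro adjacency_closed_eq_vertices[of K u])
      (auto simp: tight_set_def neighbourhood_def dest: adjacent_in_vertices)
  moreover have "L \<noteq> {}" "L \<subseteq> vertices G" using L by (auto simp: tight_set_def)
  ultimately show False using K(2) L(2) by blast
qed

text \<open>
  If \<open>K\<close> avoids \<open>A \<inter> B\<close>, then \<open>K\<close> and with it \<open>C \<inter> D = N(K)\<close> lies on one side of \<open>{A, B}\<close>,
  say \<open>A\<close>. A tight component at \<open>A \<inter> B\<close> in \<open>B\<close> then puts \<open>A \<inter> B\<close> on one side of \<open>{C, D}\<close>, and
  the part of \<open>B\<close> on the other side has no neighbours.
\<close>

lemma crossing_separator_meets_tight_set:
  assumes tight: "tight_separation G {A, B}"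
    and sep: "is_oriented_separation G (C, D)"
    and cross: "crosses {A, B} {C, D}"
    and K: "tight_set G (C \<inter> D) K"
    and disj: "(A \<inter> B) \<inter> (C \<inter> D) = {}"
  shows "K \<inter> (A \<inter> B) \<noteq> {}"
proof
  assume KX: "K \<inter> (A \<inter> B) = {}"
  have nest: "nested {A, B} {C, D}"
    if tight: "tight_separation G {A, B}" and disj: "(A \<inter> B) \<inter> (C \<inter> D) = {}"
      and KA: "K \<subseteq> A - B" "C \<inter> D \<subseteq> A" for A B
  proof -
    have AB: "is_oriented_separation G (B, A)"
      using tight tight_separation_imp_oriented is_oriented_separation_commute by blast
    have BY: "B \<inter> (C \<inter> D) = {}" using disj KA by auto
    obtain L where L: "tight_set G (B \<inter> A) L" "L \<subseteq> B - A"
      using tight_separation_tight_set tight tight_separation_commute by metis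
    have XCD: "B \<inter> A \<subseteq> C \<or> B \<inter> A \<subseteq> D"
      using tight_set_side[OF sep L(1)] L(2) BY by blast
    \<comment> \<open>No vertex of \<open>B \<inter> D\<close> lies in \<open>A\<close> or in
      \<open>C\<close>, so both separations keep its neighbours in \<open>B \<inter> D\<close>; this
      set would be everything, yet it misses \<open>K\<close>. The names \<open>C\<close> and
      \<open>D\<close> are rebound to serve both cases of \<open>XCD\<close>.\<close>
    have far: "B \<inter> D = {}" if sep: "is_oriented_separation G (D, C)"
      and XC: "B \<inter> A \<subseteq> C" and BY: "B \<inter> (C \<inter> D) = {}" for C D
    proof (rule ccontr)
      assume "B \<inter> D \<noteq> {}"
      then obtain u where "u \<in> B \<inter> D" by auto
      then have "B \<inter> D = vertices G"
      proof (rule adjacency_closed_eq_vertices[rotated])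
        show "B \<inter> D \<subseteq> vertices G" using AB by (auto simp: is_oriented_separation_iff)
      next
        fix a b assume ab: "a \<in> B \<inter> D" "adjacent G a b"
        then have "a \<notin> A" "a \<notin> C" using XC BY by auto
        then show "b \<in> B \<inter> D"
          using ab separation_adjacent[OF AB, of a b] separation_adjacent[OF sep, of a b]
            adjacent_in_vertices by auto
      qed
      then show False using KA K by (auto simp: tight_set_def)
    qed
    \<comment> \<open>Both pairs cover all vertices, so an empty \<open>B \<inter> D\<close> means
      \<open>B \<subseteq> C\<close> and \<open>D \<subseteq> A\<close>, which is nestedness;
      \<open>B \<inter> C\<close> is symmetric.\<close>
    have "B \<inter> D = {} \<or> B \<inter> C = {}"
      using XCD far[of D C] far[of C D] sep BY is_oriented_separation_commute[of G C D]
      by (auto simp: Int_commute)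
    moreover have "A \<union> B = C \<union> D"
      using sep AB by (auto simp: is_oriented_separation_iff)
    ultimately show ?thesis unfolding nested_iff by blast
  qed
  have "K \<subseteq> A - B \<and> C \<inter> D \<subseteq> A \<or> K \<subseteq> B - A \<and> C \<inter> D \<subseteq> B"
    using tight_set_side[OF tight_separation_imp_oriented[OF tight] K KX] .
  then have "nested {A, B} {C, D}"
    using nest[of A B] nest[of B A] tight disj
    by (auto simp: insert_commute Int_commute)
  with cross show False by (simp add: crosses_def)
qed

section \<open>Finiteness of the crossing numbers\<close>

text \<open>Every separator in the set below meets a fixed path in \<open>G - F\<close>.\<close>

lemma finite_minimal_separators:
  "finite {Y. finite Y \<and> card Y = n \<and> \<not> reach G (vertices G - (F \<union> Y)) u v \<and>
     (\<forall>y\<in>Y. reach G (vertices G - (F \<union> (Y - {y}))) u v)}" (is "finite (?S n F)")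
proof (induction n arbitrary: F)
  case 0
  have "?S 0 F \<subseteq> {{}}" by auto
  then show ?case by (rule finite_subset) simp
next
  case (Suc n)
  show ?case
  proof (cases "reach G (vertices G - F) u v")
    case False
    have "?S (Suc n) F = {}"
    proof (rule ccontr)
      assume "?S (Suc n) F \<noteq> {}"
      then obtain Y where Y: "Y \<in> ?S (Suc n) F" by auto
      then obtain y where "y \<in> Y" by fastforce
      with Y have "reach G (vertices G - (F \<union> (Y - {y}))) u v" by auto
      then have "reach G (vertices G - F) u v" by (rule reach_mono) auto
      with False show False by simp
    qed
    then show ?thesis by (simp only: finite.emptyI)
  next
    case True
    then obtain P where P: "finite P" "P \<subseteq> vertices G - F" "reach G P u v"
      by (rule reach_finite_support)
    \<comment> \<open>Moving a vertex \<open>p\<close> of the path from \<open>Y\<close> to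
      \<open>F\<close> preserves \<open>F \<union> Y\<close> and the minimality at the remaining
      vertices, and lowers the size to \<open>n\<close>.\<close>
    have "?S (Suc n) F \<subseteq> (\<Union>p\<in>P. insert p ` ?S n (insert p F))"
    proof
      fix Y assume Y: "Y \<in> ?S (Suc n) F"
      have "P \<inter> Y \<noteq> {}"
      proof
        assume "P \<inter> Y = {}"
        then have "reach G (vertices G - (F \<union> Y)) u v"
          using P by (intro reach_mono[OF P(3)]) auto
        with Y show False by auto
      qed
      then obtain p where p: "p \<in> P" "p \<in> Y" by auto
      have eq: "insert p F \<union> (Y - {p}) = F \<union> Y" using p by auto
      have eq': "insert p F \<union> ((Y - {p}) - {y}) = F \<union> (Y - {y})" if "y \<in> Y - {p}" for y
        using p that by auto
      have "Y - {p} \<in> ?S n (insert p F)"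
        using Y p eq eq' by auto
      moreover have "Y = insert p (Y - {p})" using p by auto
      ultimately show "Y \<in> (\<Union>p\<in>P. insert p ` ?S n (insert p F))" using p by blast
    qed
    then show ?thesis by (rule finite_subset) (intro finite_UN_I finite_imageI P(1) Suc)
  qed
qed

text \<open>\<open>C\<close> consists of \<open>Y\<close> and some components of
  \<open>G - Y\<close>. By connectedness each component contains a neighbour of \<open>Y\<close>, so
  the trace of \<open>C\<close> on the finite set of these neighbours determines \<open>C\<close>
  and hence \<open>D\<close>.\<close>

lemma finite_separations_with_separator:
  assumes Y: "finite Y" "Y \<noteq> {}"
  shows "finite {(C, D). is_oriented_separation G (C, D) \<and> C \<inter> D = Y}" (is "finite ?T")
proof -
  let ?N = "{w. \<exists>y\<in>Y. adjacent G y w}"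
  have sub: "C \<subseteq> C'"
    if "is_oriented_separation G (C, D)" "C \<inter> D = Y" "is_oriented_separation G (C', D')" "C' \<inter> D' = Y"
      "C \<inter> ?N = C' \<inter> ?N" for C D C' D'
  proof (rule ccontr)
    assume "\<not> C \<subseteq> C'"
    then obtain v where v: "v \<in> C - C'" by auto
    \<comment> \<open>An edge leaving \<open>C - C'\<close> would end in \<open>Y\<close>. Its start
      would then be a neighbour of \<open>Y\<close> in \<open>C\<close> but not in
      \<open>C'\<close>, contrary to the equal traces.\<close>
    have "C - C' = vertices G"
    proof (rule adjacency_closed_eq_vertices[OF _ v])
      show "C - C' \<subseteq> vertices G" using that by (auto simp: is_oriented_separation_iff)
    next
      fix a b assume ab: "a \<in> C - C'" "adjacent G a b"
      have verts: "a \<in> vertices G" "b \<in> vertices G" using ab adjacent_in_vertices by auto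
      have "a \<notin> D" "a \<in> D'"
        using ab that verts by (auto simp: is_oriented_separation_iff)
      then have "b \<in> C" "b \<in> D'"
        using ab verts that separation_adjacent[of G C D a b] separation_adjacent[of G D' C' a b]
        by (auto simp: is_oriented_separation_commute)
      moreover have "b \<notin> C'"
      proof
        assume "b \<in> C'"
        then have "b \<in> Y" using \<open>b \<in> D'\<close> that by auto
        then have "a \<in> ?N" using ab(2) adjacent_commute[of G a b] by blast
        then have "a \<in> C'" using ab(1) that(5) by blast
        then show False using ab(1) by simp
      qed
      ultimately show "b \<in> C - C'" by simp
    qed
    moreover have "Y \<subseteq> C'" "Y \<subseteq> C" using that by auto
    ultimately show False using Y that by (auto simp: is_oriented_separation_iff)
  qed
  have "inj_on (\<lambda>(C, D). C \<inter> ?N) ?T"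
  proof (rule inj_onI)
    fix p q assume pq: "p \<in> ?T" "q \<in> ?T"
      and eq: "(case p of (C, D) \<Rightarrow> C \<inter> ?N) = (case q of (C, D) \<Rightarrow> C \<inter> ?N)"
    obtain C D C' D' where CD: "p = (C, D)" "q = (C', D')" by (cases p, cases q)
    have h: "is_oriented_separation G (C, D)" "C \<inter> D = Y"
      "is_oriented_separation G (C', D')" "C' \<inter> D' = Y"
      using pq CD by simp_all
    have N: "C \<inter> ?N = C' \<inter> ?N" using eq CD by simp
    have "C = C'"
      using sub[OF h N] sub[OF h(3,4) h(1,2) N[symmetric]] by (rule equalityI)
    moreover have "D = (vertices G - C) \<union> Y" "D' = (vertices G - C') \<union> Y"
      using h by (auto simp: is_oriented_separation_iff)
    ultimately show "p = q" using CD by simp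
  qed
  moreover have "finite ((\<lambda>(C, D). C \<inter> ?N) ` ?T)"
    by (rule finite_subset[of _ "Pow ?N"]) (use finite_neighbours[OF Y(1)] in auto)
  ultimately show ?thesis by (rule finite_imageD[rotated])
qed

text \<open>Walks avoiding \<open>Y = N(K)\<close> cannot leave \<open>K\<close>, whereas each
  \<open>y\<close> in \<open>Y\<close> has neighbours in both \<open>K\<close> and \<open>L\<close>
  and, once restored, joins them.\<close>

lemma tight_sets_minimal_separator:
  assumes K: "tight_set G Y K" and L: "tight_set G Y L" and disj: "K \<inter> L = {}"
    and uv: "u \<in> K" "v \<in> L"
  shows "\<not> reach G (vertices G - Y) u v"
    and "\<And>y. y \<in> Y \<Longrightarrow> reach G (vertices G - (Y - {y})) u v"
proof -
  show "\<not> reach G (vertices G - Y) u v"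
  proof
    assume "reach G (vertices G - Y) u v"
    then have "v \<in> K"
      by (rule reach_closed) (use uv K in \<open>auto simp: tight_set_def neighbourhood_def\<close>)
    with uv disj show False by auto
  qed
next
  fix y assume y: "y \<in> Y"
  let ?U = "vertices G - (Y - {y})"
  have to_y: "reach G ?U w y" if M: "tight_set G Y M" and w: "w \<in> M" for M w
  proof -
    obtain a where a: "a \<in> M" "adjacent G a y" "y \<in> vertices G"
      using M y by (auto simp: tight_set_def neighbourhood_def)
    have "reach G M w a" using M w a by (auto simp: tight_set_def)
    then have "reach G ?U w a"
      by (rule reach_mono) (use M in \<open>auto simp: tight_set_def\<close>)
    moreover have "reach G ?U a y"
      by (rule reach_step) (use M a in \<open>auto simp: tight_set_def\<close>)
    ultimately show ?thesis by (rule reach_trans)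
  qed
  show "reach G ?U u v"
    using to_y[OF K uv(1)] reach_commute[OF to_y[OF L uv(2)]] by (rule reach_trans)
qed

lemma finite_crossing_tight_separations:
  assumes tight: "tight_separation G {A, B}" and fin: "finite (A \<inter> B)"
  shows "finite {t. tight_separation G t \<and> has_order t n \<and> crosses {A, B} t}" (is "finite ?T")
proof -
  define W where "W = (A \<inter> B) \<union> {w. \<exists>y\<in>A \<inter> B. adjacent G y w}"
  \<comment> \<open>The union with \<open>{}\<close> matches
    \<open>finite_minimal_separators\<close> at \<open>F = {}\<close>.\<close>
  define \<Y> where "\<Y> = (\<Union>u\<in>W. \<Union>v\<in>W. {Y. finite Y \<and> card Y = n \<and>
     \<not> reach G (vertices G - ({} \<union> Y)) u v \<and> (\<forall>y\<in>Y. reach G (vertices G - ({} \<union> (Y - {y}))) u v)})"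
  have "finite W" using fin finite_neighbours by (simp add: W_def)
  \<comment> \<open>The empty set is dropped because
    \<open>finite_separations_with_separator\<close> asks for a non-empty separator;
    \<open>separator_nonempty\<close> shows that nothing is lost.\<close>
  then have fin\<Y>: "finite (\<Y> - {{}})"
    unfolding \<Y>_def by (intro finite_Diff finite_UN_I finite_minimal_separators)
  have "?T \<subseteq> (\<lambda>(C, D). {C, D}) ` (\<Union>Y\<in>\<Y> - {{}}. {(C, D). is_oriented_separation G (C, D) \<and> C \<inter> D = Y})"
  proof
    fix t assume t: "t \<in> ?T"
    then obtain C D where CD: "t = {C, D}"
      by (auto simp: tight_separation_def is_separation_def)
    have tightC: "tight_separation G {C, D}" and cross: "crosses {A, B} {C, D}"
      and order: "finite (C \<inter> D)" "card (C \<inter> D) = n"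
      using t CD by (auto simp: has_order_def)
    note sep = tight_separation_imp_oriented[OF tightC]
    obtain K where K: "tight_set G (C \<inter> D) K" "K \<subseteq> C - D"
      using tight_separation_tight_set[OF tightC] .
    obtain L where L: "tight_set G (C \<inter> D) L" "L \<subseteq> D - C"
      using tight_separation_tight_set[of G D C] tightC by (auto simp: insert_commute Int_commute)
    \<comment> \<open>If the separators meet, a common vertex has a neighbour in \<open>K\<close>
      because \<open>N(K) = C \<inter> D\<close>. Otherwise crossing forces \<open>K\<close> to meet
      \<open>A \<inter> B\<close> itself.\<close>
    have KW: "\<exists>u. u \<in> K \<and> u \<in> W" if K: "tight_set G (C \<inter> D) K" for K
    proof (cases "(A \<inter> B) \<inter> (C \<inter> D) = {}")
      case True
      then show ?thesis
        using crossing_separator_meets_tight_set[OF tight sep cross K] by (auto simp: W_def)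
    next
      case False
      then obtain y where "y \<in> A \<inter> B" "y \<in> neighbourhood G K"
        using K by (auto simp: tight_set_def)
      then show ?thesis using adjacent_commute[of G y] by (auto simp: W_def neighbourhood_def)
    qed
    obtain u v where uv: "u \<in> K" "u \<in> W" "v \<in> L" "v \<in> W" using KW K(1) L(1) by blast
    have "K \<inter> L = {}" using K L by auto
    note sepr = tight_sets_minimal_separator[OF K(1) L(1) this uv(1,3)]
    have "C \<inter> D \<in> \<Y>"
      unfolding \<Y>_def using uv(2,4) sepr order by auto
    with separator_nonempty[OF tightC] have "C \<inter> D \<in> \<Y> - {{}}" by simp
    then show "t \<in> (\<lambda>(C, D). {C, D}) ` (\<Union>Y\<in>\<Y> - {{}}. {(C, D). is_oriented_separation G (C, D) \<and> C \<inter> D = Y})"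
      using sep CD by (intro image_eqI[of _ _ "(C, D)"]) auto
  qed
  moreover have "finite {(C, D). is_oriented_separation G (C, D) \<and> C \<inter> D = Y}"
    if "Y \<in> \<Y> - {{}}" for Y
    using that by (intro finite_separations_with_separator) (auto simp: \<Y>_def)
  ultimately show ?thesis
    using fin\<Y> by (meson finite_UN_I finite_imageI finite_subset)
qed

end

section \<open>Corners\<close>

text \<open>Exchanging \<open>A\<close> with \<open>B\<close> or \<open>C\<close> with
  \<open>D\<close> gives the four corners; \<open>corner A B C D\<close> and
  \<open>corner B A D C\<close> are opposite.\<close>

definition corner :: "'a set \<Rightarrow> 'a set \<Rightarrow> 'a set \<Rightarrow> 'a set \<Rightarrow> 'a separation" where
  "corner A B C D = {A \<inter> C, B \<union> D}"

definition corner_order :: "'a set \<Rightarrow> 'a set \<Rightarrow> 'a set \<Rightarrow> 'a set \<Rightarrow> nat" where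
  "corner_order A B C D = card (A \<inter> C \<inter> (B \<union> D))"

lemma corner_commute: "corner A B C D = corner C D A B"
  by (simp add: corner_def Int_commute Un_commute)

lemma corner_order_commute: "corner_order A B C D = corner_order C D A B"
  by (simp add: corner_order_def Int_commute Un_commute)

lemma has_order_corner: "has_order (corner A B C D) k \<Longrightarrow> corner_order A B C D = k"
  by (simp add: has_order_def corner_def corner_order_def)

text \<open>The separators of two opposite corners have the same union and the same intersection as
  \<open>A \<inter> B\<close> and \<open>C \<inter> D\<close>.\<close>

lemma corner_order_add_opposite:
  assumes "A \<union> B = C \<union> D" "finite (A \<inter> B)" "finite (C \<inter> D)"
  shows "corner_order A B C D + corner_order B A D C = card (A \<inter> B) + card (C \<inter> D)"
proof -
  let ?P = "A \<inter> C \<inter> (B \<union> D)" and ?Q = "B \<inter> D \<inter> (A \<union> C)"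
  have un: "?P \<union> ?Q = (A \<inter> B) \<union> (C \<inter> D)" and int: "?P \<inter> ?Q = (A \<inter> B) \<inter> (C \<inter> D)"
    using assms(1) by blast+
  have "finite (?P \<union> ?Q)" unfolding un using assms by simp
  then have "finite ?P" "finite ?Q" by simp_all
  then have "card ?P + card ?Q = card (?P \<union> ?Q) + card (?P \<inter> ?Q)"
    by (rule card_Un_Int)
  also have "\<dots> = card (A \<inter> B) + card (C \<inter> D)"
    unfolding un int using assms by (intro card_Un_Int[symmetric])
  finally show ?thesis by (simp add: corner_order_def)
qed

lemma is_oriented_separation_corner:
  assumes "is_oriented_separation G (A, B)" "is_oriented_separation G (C, D)"
  shows "is_oriented_separation G (A \<inter> C, B \<union> D)"
  using assms unfolding is_oriented_separation_iff by blast

section \<open>Nestedness of corners with other separations\<close>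

lemma nested_corner_left: "nested (corner A B C D) {A, B}"
  unfolding corner_def nested_iff by blast

lemma nested_corner_right: "nested (corner A B C D) {C, D}"
  unfolding corner_def nested_iff by blast

text \<open>A comparison with \<open>A\<close> or \<open>C\<close> as the smaller side passes to
  \<open>A \<inter> C\<close>. Otherwise both \<open>B\<close> and \<open>D\<close> are smaller
  sides: if both lie in the same one of \<open>E\<close> and \<open>F\<close>, so does
  \<open>B \<union> D\<close>; if not, \<open>{A, B}\<close> and \<open>{C, D}\<close> would be
  nested.\<close>

lemma nested_corner:
  assumes "crosses {A, B} {C, D}" "nested {A, B} {E, F}" "nested {C, D} {E, F}"
  shows "nested (corner A B C D) {E, F}"
proof -
  note h = assms[unfolded crosses_def nested_iff]
  have "B \<subseteq> C \<and> D \<subseteq> A" if "B \<subseteq> E \<and> F \<subseteq> A" "D \<subseteq> F \<and> E \<subseteq> C" using that by blast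
  moreover have "B \<subseteq> C \<and> D \<subseteq> A" if "B \<subseteq> F \<and> E \<subseteq> A" "D \<subseteq> E \<and> F \<subseteq> C" using that by blast
  ultimately consider "A \<subseteq> E \<and> F \<subseteq> B" | "A \<subseteq> F \<and> E \<subseteq> B" | "C \<subseteq> E \<and> F \<subseteq> D" | "C \<subseteq> F \<and> E \<subseteq> D"
    | "B \<subseteq> E \<and> F \<subseteq> A" "D \<subseteq> E \<and> F \<subseteq> C" | "B \<subseteq> F \<and> E \<subseteq> A" "D \<subseteq> F \<and> E \<subseteq> C"
    using h by argo
  then show ?thesis
    unfolding corner_def nested_iff by cases (simp_all add: le_infI1 le_infI2 le_supI1 le_supI2)
qed

text \<open>A comparison with smaller side \<open>A\<close> passes to the corner inside
  \<open>A\<close>, one with smaller side \<open>B\<close> to the opposite corner inside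
  \<open>B\<close>.\<close>

lemma nested_opposite_corners:
  assumes "nested {A, B} {E, F}"
  shows "nested (corner A B C D) {E, F} \<or> nested (corner B A D C) {E, F}"
  using assms unfolding corner_def nested_iff by blast

section \<open>The \<open>\<top>\<close>-star of two corners\<close>

text \<open>The base is oriented as \<open>(B, A)\<close>, which makes the strict sides of the three
  separations pairwise disjoint. Every index other than 1 and 2 gets the third value.\<close>

definition corner_star_fst :: "'a set \<Rightarrow> 'a set \<Rightarrow> 'a set \<Rightarrow> 'a set \<Rightarrow> nat \<Rightarrow> 'a set" where
  "corner_star_fst A B C D i = (if i = 1 then B else if i = 2 then A \<inter> C else A \<inter> D)"

definition corner_star_snd :: "'a set \<Rightarrow> 'a set \<Rightarrow> 'a set \<Rightarrow> 'a set \<Rightarrow> nat \<Rightarrow> 'a set" where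
  "corner_star_snd A B C D i = (if i = 1 then A else if i = 2 then B \<union> D else B \<union> C)"

lemma corner_star_simps [simp]:
  "corner_star_fst A B C D (Suc 0) = B"
  "corner_star_fst A B C D 2 = A \<inter> C"
  "corner_star_fst A B C D 3 = A \<inter> D"
  "corner_star_snd A B C D (Suc 0) = A"
  "corner_star_snd A B C D 2 = B \<union> D"
  "corner_star_snd A B C D 3 = B \<union> C"
  by (simp_all add: corner_star_fst_def corner_star_snd_def)

lemma corner_star_parts:
  fixes A B C D :: "'a set"
  defines "P \<equiv> corner_star_fst A B C D" and "Q \<equiv> corner_star_snd A B C D"
  shows "star_centre P Q = A \<inter> B \<inter> (C \<inter> D)"
    and "star_link P Q 2 3 = (A - B) \<inter> (C \<inter> D)"
    and "A \<union> B = C \<union> D \<Longrightarrow> star_link P Q 1 2 = A \<inter> B \<inter> (C - D)"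
    and "A \<union> B = C \<union> D \<Longrightarrow> star_link P Q 1 3 = A \<inter> B \<inter> (D - C)"
  by (auto simp: P_def Q_def star_centre_def star_link_def star_sep_def)

text \<open>Follow \<open>K\<close> from a neighbour of \<open>x\<close> until it first leaves \<open>(A - B) \<inter> (C - D)\<close>.\<close>

lemma tight_set_links_to_separator:
  assumes AB: "is_oriented_separation G (A, B)" and CD: "is_oriented_separation G (C, D)"
    and K: "tight_set G (C \<inter> D) K" "K \<subseteq> C - D"
    and x: "x \<in> (A - B) \<inter> (C \<inter> D)"
    and meets: "K \<inter> (A \<inter> B) \<noteq> {} \<or> A \<inter> B \<inter> (C \<inter> D) \<noteq> {}"
  shows "(\<exists>y \<in> A \<inter> B \<inter> (C - D). adjacent G x y) \<or>
    (\<exists>y \<in> A \<inter> B \<inter> C. \<exists>L \<in> graph_components (induced_subgraph G ((A - B) \<inter> (C - D))).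
       x \<in> neighbourhood G L \<and> y \<in> neighbourhood G L)"
proof -
  have V: "A \<union> B = vertices G" "C \<union> D = vertices G"
    using AB CD by (auto simp: is_oriented_separation_iff)
  obtain u where u: "u \<in> K" "adjacent G u x"
  proof -
    have "x \<in> neighbourhood G K" using K(1) x by (simp add: tight_set_def)
    then show thesis using that by (auto simp: neighbourhood_def)
  qed
  have xu: "adjacent G x u" using u adjacent_commute by metis
  have uV: "u \<in> vertices G" using u K by (auto simp: tight_set_def)
  have uA: "u \<in> A" using separation_adjacent[OF AB xu] x uV by auto
  show ?thesis
  proof (cases "u \<in> B")
    case True
    then show ?thesis using u uA K(2) xu by blast
  next
    case False
    let ?U = "(A - B) \<inter> (C - D)"
    let ?L = "{v. reach G ?U u v}"
    have uU: "u \<in> ?U" using False uA u K(2) by auto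
    have L: "?L \<in> graph_components (induced_subgraph G ?U)"
      by (rule component_containing[OF uU]) (use V in auto)
    have LU: "?L \<subseteq> ?U"
    proof
      fix v assume "v \<in> ?L"
      then have "reach G ?U u v" by simp
      then show "v \<in> ?U" by (rule reach_closed[OF _ uU])
    qed
    have nbr: "b \<in> neighbourhood G ?L" if "a \<in> ?L" "b \<notin> ?U" "b \<in> vertices G" "adjacent G a b" for a b
      using that LU unfolding neighbourhood_def by blast
    have xL: "x \<in> neighbourhood G ?L"
      by (rule nbr[of u]) (use x u V reach_refl[of G ?U u] in auto)
    have "\<exists>y \<in> A \<inter> B \<inter> C. y \<in> neighbourhood G ?L"
    \<comment> \<open>If \<open>K\<close> stays in \<open>?L\<close>, it avoids
      \<open>A \<inter> B\<close>, so \<open>meets\<close> provides a vertex of both separators, and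
      this is a neighbour of \<open>K\<close>. Otherwise an edge of \<open>K\<close> leaves
      \<open>?L\<close>; its end stays in \<open>C - D\<close> and so must lie in
      \<open>A \<inter> B\<close>.\<close>
    proof (cases "K \<subseteq> ?L")
      case True
      then have "K \<inter> (A \<inter> B) = {}" using LU by blast
      then obtain y where y: "y \<in> A \<inter> B \<inter> (C \<inter> D)" using meets by blast
      then have "y \<in> neighbourhood G K" using K(1) by (simp add: tight_set_def)
      then obtain a where "a \<in> K" "adjacent G a y" by (auto simp: neighbourhood_def)
      then have "y \<in> neighbourhood G ?L" using True y V by (intro nbr[of a]) auto
      then show ?thesis using y by blast
    next
      case False
      have "\<exists>a b. a \<in> K \<and> b \<in> K \<and> a \<in> ?L \<and> b \<notin> ?L \<and> adjacent G a b"
      proof (rule ccontr)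
        assume none: "\<not> ?thesis"
        have "v \<in> ?L" if "v \<in> K" for v
        proof (rule reach_closed[of G K u v])
          show "reach G K u v" using K(1) u that by (simp add: tight_set_def)
          show "u \<in> ?L" by (simp add: reach_refl)
          show "b \<in> ?L" if "a \<in> ?L" "a \<in> K" "b \<in> K" "adjacent G a b" for a b
            using none that by blast
        qed
        with False show False by blast
      qed
      then obtain a b where ab: "a \<in> K" "b \<in> K" "a \<in> ?L" "b \<notin> ?L" "adjacent G a b" by blast
      have aU: "a \<in> ?U" using ab LU by blast
      have bV: "b \<in> vertices G" using ab K by (auto simp: tight_set_def)
      have bU: "b \<notin> ?U"
      proof
        assume "b \<in> ?U"
        then have "reach G ?U a b" using ab aU by (intro reach_step)
        then have "reach G ?U u b" using ab(3) reach_trans by fastforce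
        with ab show False by simp
      qed
      have "b \<in> A" using separation_adjacent[OF AB ab(5)] aU bV by auto
      moreover have "b \<in> C - D" using ab K(2) by blast
      ultimately have "b \<in> A \<inter> B \<inter> C" using bU by blast
      then show ?thesis using nbr[OF ab(3) bU bV ab(5)] by blast
    qed
    then show ?thesis using L xL by blast
  qed
qed

context connected_locally_finite_graph
begin

text \<open>
  The order bound is needed only for distinctness: the two corners coincide just if
  \<open>A \<subseteq> C \<inter> D\<close>, and then their separator \<open>A\<close> properly contains \<open>A \<inter> B\<close>.
\<close>

lemma relevant_corner_star:
  assumes tight: "tight_separation G {A, B}" "tight_separation G {C, D}"
    and cross: "crosses {A, B} {C, D}"
    and fin: "finite (C \<inter> D)"
    and order: "corner_order A B C D \<le> card (A \<inter> B)"
  shows "relevant_top_star G (corner_star_fst A B C D) (corner_star_snd A B C D)"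
proof -
  let ?P = "corner_star_fst A B C D" and ?Q = "corner_star_snd A B C D"
  note AB = tight_separation_imp_oriented[OF tight(1)] and CD = tight_separation_imp_oriented[OF tight(2)]
  have DC: "is_oriented_separation G (D, C)" and BA: "is_oriented_separation G (B, A)"
    using AB CD is_oriented_separation_commute by blast+
  have V: "A \<union> B = vertices G" "C \<union> D = vertices G"
    using AB CD by (auto simp: is_oriented_separation_iff)
  obtain K where K: "tight_set G (A \<inter> B) K" "K \<subseteq> A - B"
    using tight_separation_tight_set[OF tight(1)] .
  have A: "A - B \<noteq> {}" using K by (auto simp: tight_set_def)
  obtain K' where K': "tight_set G (B \<inter> A) K'" "K' \<subseteq> B - A"
    using tight_separation_tight_set tight(1) tight_separation_commute by metis
  have B: "B - A \<noteq> {}" using K' by (auto simp: tight_set_def)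
  have seps: "\<forall>i\<in>{1,2,3}. is_oriented_separation G (?P i, ?Q i)"
    using BA is_oriented_separation_corner[OF AB CD] is_oriented_separation_corner[OF AB DC] by simp
  have ne: "\<not> (A \<inter> C = A \<inter> D \<and> B \<union> D = B \<union> C)"
  proof
    assume eq: "A \<inter> C = A \<inter> D \<and> B \<union> D = B \<union> C"
    then have "A \<inter> C \<inter> (B \<union> D) = A" using V by blast
    moreover have "finite A"
    proof (rule finite_subset)
      show "A \<subseteq> C \<inter> D" using eq V by blast
    qed (rule fin)
    moreover have "A \<inter> B \<subset> A" using A by blast
    ultimately have "card (A \<inter> B) < corner_order A B C D"
      unfolding corner_order_def by (simp add: psubset_card_mono)
    with order show False by simp
  qed
  have inj: "inj_on (\<lambda>i. (?P i, ?Q i)) {1,2,3}"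
    using ne B by (auto simp: inj_on_def)
  have disj: "\<forall>i\<in>{1,2,3}. \<forall>j\<in>{1,2,3}. i \<noteq> j \<longrightarrow> (?P i - ?Q i) \<inter> (?P j - ?Q j) = {}"
    by auto
  have un: "(\<Union>i\<in>{1,2,3}. ?P i - ?Q i) = vertices G - (\<Union>i\<in>{1,2,3}. star_sep ?P ?Q i)"
    using V by (auto simp: star_sep_def)
  have two: "\<forall>i\<in>{1,2,3}. \<forall>v \<in> star_sep ?P ?Q i. \<exists>j\<in>{1,2,3}. j \<noteq> i \<and> v \<in> star_sep ?P ?Q j"
    using V by (auto simp: star_sep_def)
  have star: "top_star G ?P ?Q"
    unfolding top_star_def using seps inj disj un two by blast
  have meets: "L \<inter> (A \<inter> B) \<noteq> {} \<or> A \<inter> B \<inter> (C \<inter> D) \<noteq> {}" if "tight_set G (C \<inter> D) L" for L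
    using crossing_separator_meets_tight_set[OF tight(1) CD cross that] by blast
  obtain L where L: "tight_set G (C \<inter> D) L" "L \<subseteq> C - D"
    using tight_separation_tight_set[OF tight(2)] .
  obtain M where M: "tight_set G (C \<inter> D) M" "M \<subseteq> D - C"
    using tight_separation_tight_set[of G D C] tight(2) by (auto simp: insert_commute Int_commute)
  have link: "(\<exists>y \<in> star_link ?P ?Q 1 i. adjacent G x y) \<or>
        (\<exists>y \<in> star_link ?P ?Q 1 i \<union> star_centre ?P ?Q.
           \<exists>K \<in> graph_components (induced_subgraph G (?P i - ?Q i)).
             x \<in> neighbourhood G K \<and> y \<in> neighbourhood G K)"
    if x: "x \<in> star_link ?P ?Q 2 3" and i: "i \<in> {2,3}" for x i
  proof -
    have x': "x \<in> (A - B) \<inter> (C \<inter> D)" using x by (simp add: corner_star_parts)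
    have ABCD: "A \<union> B = C \<union> D" using V by simp
    consider "i = 2" | "i = 3" using i by auto
    then show ?thesis
    proof cases
      case 1
      have "star_link ?P ?Q 1 i = A \<inter> B \<inter> (C - D)"
        unfolding 1 by (rule corner_star_parts(3)[OF ABCD])
      moreover have "star_link ?P ?Q 1 i \<union> star_centre ?P ?Q = A \<inter> B \<inter> C"
        unfolding calculation corner_star_parts(1) by blast
      moreover have "?P i - ?Q i = (A - B) \<inter> (C - D)" using 1 by auto
      ultimately show ?thesis
        using tight_set_links_to_separator[OF AB CD L x' meets[OF L(1)]] by (simp only:)
    next
      case 2
      have "star_link ?P ?Q 1 i = A \<inter> B \<inter> (D - C)"
        unfolding 2 by (rule corner_star_parts(4)[OF ABCD])
      moreover have "star_link ?P ?Q 1 i \<union> star_centre ?P ?Q = A \<inter> B \<inter> D"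
        unfolding calculation corner_star_parts(1) by blast
      moreover have "?P i - ?Q i = (A - B) \<inter> (D - C)" using 2 by auto
      ultimately show ?thesis
        using tight_set_links_to_separator[OF AB DC, unfolded Int_commute[of D C], OF M x' meets[OF M(1)]]
        by (simp only:)
    qed
  qed
  have "tight_separation G {?P 1, ?Q 1}" using tight(1) by (simp add: insert_commute)
  with star link show ?thesis unfolding relevant_top_star_def by blast
qed

lemma bottleneck_contains_corner:
  assumes \<beta>: "bottleneck G k \<beta>" "{A, B} \<in> \<beta>"
    and tight: "tight_separation G {C, D}" and fin: "finite (C \<inter> D)"
    and cross: "crosses {A, B} {C, D}"
    and order: "corner_order A B C D \<le> k" "corner_order A B D C \<le> k"
  shows "corner A B C D \<in> \<beta> \<or> corner A B D C \<in> \<beta>"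
proof -
  let ?P = "corner_star_fst A B C D" and ?Q = "corner_star_snd A B C D"
  have AB: "tight_separation G {A, B}" "finite (A \<inter> B)" "card (A \<inter> B) = k"
    using \<beta> by (auto simp: bottleneck_def has_order_def)
  have "relevant_top_star G ?P ?Q"
    by (rule relevant_corner_star[OF AB(1) tight cross fin]) (use order AB in simp)
  moreover have "star_order_le ?P ?Q k"
  proof -
    have "finite (A \<inter> C \<inter> (B \<union> D))" "finite (A \<inter> D \<inter> (B \<union> C))"
      by (rule finite_subset[of _ "(A \<inter> B) \<union> (C \<inter> D)"]; use AB fin in auto)+
    then show ?thesis
      using AB order
      by (auto simp: star_order_le_def has_order_def corner_order_def Int_commute)
  qed
  moreover have "{?P 1, ?Q 1} \<in> \<beta>" using \<beta> by (simp add: insert_commute)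
  ultimately have "{?P 2, ?Q 2} \<in> \<beta> \<or> {?P 3, ?Q 3} \<in> \<beta>"
    using \<beta>(1) unfolding bottleneck_def by blast
  then show ?thesis by (simp add: corner_def)
qed

section \<open>Uncrossing\<close>

lemma bottleneck_separation:
  assumes "bottleneck G k \<beta>" "s \<in> \<beta>"
  obtains A B where "s = {A, B}" "tight_separation G {A, B}" "A \<union> B = vertices G"
    "finite (A \<inter> B)" "card (A \<inter> B) = k"
proof -
  have s: "tight_separation G s" "has_order s k" using assms by (auto simp: bottleneck_def)
  then obtain A B where "s = {A, B}" "is_oriented_separation G (A, B)"
    by (auto simp: tight_separation_def is_separation_def)
  with s show thesis by (intro that[of A B]) (auto simp: has_order_def is_oriented_separation_iff)
qed

text \<open>Four stars are available: base \<open>{A, B}\<close> with the corners in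
  \<open>A\<close> or in \<open>B\<close>, and base \<open>{C, D}\<close> with the corners in
  \<open>C\<close> or in \<open>D\<close>.\<close>

lemma crossing_corners:
  assumes \<beta>: "bottleneck G k \<beta>" "{A, B} \<in> \<beta>" and \<beta>': "bottleneck G j \<beta>'" "{C, D} \<in> \<beta>'"
    and cross: "crosses {A, B} {C, D}"
  shows "corner_order A B C D + corner_order B A D C = k + j"
    and "corner_order A B D C + corner_order B A C D = k + j"
    and "corner_order A B C D \<le> k \<Longrightarrow> corner_order A B D C \<le> k \<Longrightarrow>
      corner A B C D \<in> \<beta> \<or> corner A B D C \<in> \<beta>"
    and "corner_order B A C D \<le> k \<Longrightarrow> corner_order B A D C \<le> k \<Longrightarrow>
      corner B A C D \<in> \<beta> \<or> corner B A D C \<in> \<beta>"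
    and "corner_order A B C D \<le> j \<Longrightarrow> corner_order B A C D \<le> j \<Longrightarrow>
      corner A B C D \<in> \<beta>' \<or> corner B A C D \<in> \<beta>'"
    and "corner_order A B D C \<le> j \<Longrightarrow> corner_order B A D C \<le> j \<Longrightarrow>
      corner A B D C \<in> \<beta>' \<or> corner B A D C \<in> \<beta>'"
proof -
  have AB: "tight_separation G {A, B}" "finite (A \<inter> B)" "card (A \<inter> B) = k"
    using \<beta> by (auto simp: bottleneck_def has_order_def)
  have CD: "tight_separation G {C, D}" "finite (C \<inter> D)" "card (C \<inter> D) = j"
    using \<beta>' by (auto simp: bottleneck_def has_order_def)
  have V: "A \<union> B = C \<union> D"
    using tight_separation_imp_oriented[OF AB(1)] tight_separation_imp_oriented[OF CD(1)]
    by (simp add: is_oriented_separation_iff)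
  show "corner_order A B C D + corner_order B A D C = k + j"
    using corner_order_add_opposite[OF V AB(2) CD(2)] AB CD by simp
  show "corner_order A B D C + corner_order B A C D = k + j"
    using corner_order_add_opposite[of A B D C] V AB CD by (simp add: Un_commute Int_commute)
  show "corner A B C D \<in> \<beta> \<or> corner A B D C \<in> \<beta>"
    if "corner_order A B C D \<le> k" "corner_order A B D C \<le> k"
    using bottleneck_contains_corner[OF \<beta> CD(1,2) cross that] .
  have BA: "{B, A} = {A, B}" and DC: "{D, C} = {C, D}" by auto
  show "corner B A C D \<in> \<beta> \<or> corner B A D C \<in> \<beta>"
    if "corner_order B A C D \<le> k" "corner_order B A D C \<le> k"
    using bottleneck_contains_corner[of k \<beta> B A C D, unfolded BA, OF \<beta> CD(1,2) cross that] .
  have cross': "crosses {C, D} {A, B}" using cross by (simp add: crosses_def nested_commute)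
  show "corner A B C D \<in> \<beta>' \<or> corner B A C D \<in> \<beta>'"
    if "corner_order A B C D \<le> j" "corner_order B A C D \<le> j"
    using bottleneck_contains_corner[OF \<beta>' AB(1,2) cross'] that
    by (simp add: corner_commute[of C D] corner_order_commute[of C D])
  show "corner A B D C \<in> \<beta>' \<or> corner B A D C \<in> \<beta>'"
    if "corner_order A B D C \<le> j" "corner_order B A D C \<le> j"
    using bottleneck_contains_corner[of j \<beta>' D C A B, unfolded DC, OF \<beta>' AB(1,2) cross'] that
    by (simp add: corner_commute[of D C] corner_order_commute[of D C])
qed

text \<open>Used contrapositively: a corner of order below \<open>k\<close> lies in no
  \<open>k\<close>-bottleneck.\<close>

lemma corner_order_of_bottleneck:
  "bottleneck G k \<beta> \<Longrightarrow> corner A B C D \<in> \<beta> \<Longrightarrow> corner_order A B C D = k"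
  by (rule has_order_corner) (simp add: bottleneck_def)

text \<open>
  Otherwise two corners on the same side of \<open>{C, D}\<close> have order \<open>< j\<close>, and the star with base
  \<open>{C, D}\<close> forces one of them into \<open>\<beta>'\<close>.
\<close>

lemma corner_in_higher_bottleneck:
  assumes \<beta>: "bottleneck G k \<beta>" "{A, B} \<in> \<beta>" and \<beta>': "bottleneck G j \<beta>'" "{C, D} \<in> \<beta>'"
    and cross: "crosses {A, B} {C, D}" and "j < k"
  shows "corner A B C D \<in> \<beta> \<or> corner A B D C \<in> \<beta> \<or> corner B A C D \<in> \<beta> \<or> corner B A D C \<in> \<beta>"
proof (rule ccontr)
  assume none: "\<not> ?thesis"
  note c = crossing_corners[OF \<beta> \<beta>' cross]
  note ord = corner_order_of_bottleneck[OF \<beta>'(1)]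
  have "corner_order A B C D > k \<or> corner_order A B D C > k"
    using c(3) none by linarith
  moreover have "corner_order B A C D > k \<or> corner_order B A D C > k"
    using c(4) none by linarith
  \<comment> \<open>The two large corners cannot be opposite, since orders of opposite corners add
    up to \<open>k + j < 2 * k\<close>. Hence they lie on the same side of
    \<open>{C, D}\<close>.\<close>
  ultimately consider "corner_order A B C D > k" "corner_order B A C D > k"
    | "corner_order A B D C > k" "corner_order B A D C > k"
    using c(1,2) \<open>j < k\<close> by linarith
  then show False
  proof cases
    case 1
    then have "corner_order A B D C < j" "corner_order B A D C < j" using c(1,2) by linarith+
    with c(6) ord[of A B D C] ord[of B A D C] show False by auto
  next
    case 2
    then have "corner_order A B C D < j" "corner_order B A C D < j" using c(1,2) by linarith+
    with c(5) ord[of A B C D] ord[of B A C D] show False by auto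
  qed
qed

text \<open>The corner opposite to the large one has order below \<open>k\<close> and so lies in
  neither bottleneck. The two stars containing it must therefore contribute their other
  corner.\<close>

lemma corner_exceeding:
  assumes \<beta>: "bottleneck G k \<beta>" "{A, B} \<in> \<beta>" and \<beta>': "bottleneck G k \<beta>'" "{C, D} \<in> \<beta>'"
    and cross: "crosses {A, B} {C, D}" and large: "corner_order A B C D > k"
  shows "corner B A C D \<in> \<beta> \<and> corner A B D C \<in> \<beta>'"
proof -
  note c = crossing_corners[OF \<beta> \<beta>' cross]
  note ord = corner_order_of_bottleneck[OF \<beta>(1)] and ord' = corner_order_of_bottleneck[OF \<beta>'(1)]
  have small: "corner_order B A D C < k" using c(1) large by linarith
  \<comment> \<open>Otherwise both corners in \<open>B\<close> have order below \<open>k\<close>,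
    and the star with base \<open>{A, B}\<close> would still force one of them into
    \<open>\<beta>\<close>.\<close>
  have AD: "corner_order A B D C \<le> k"
  proof (rule ccontr)
    assume "\<not> ?thesis"
    then have "corner_order B A C D < k" using c(2) by linarith
    with small c(4) ord[of B A C D] ord[of B A D C] show False by auto
  qed
  have BC: "corner_order B A C D \<le> k"
  proof (rule ccontr)
    assume "\<not> ?thesis"
    then have "corner_order A B D C < k" using c(2) by linarith
    with small c(6) ord'[of A B D C] ord'[of B A D C] show False by auto
  qed
  have "corner B A D C \<notin> \<beta>" "corner B A D C \<notin> \<beta>'"
    using small ord[of B A D C] ord'[of B A D C] by auto
  then show ?thesis using c(4) c(6) AD BC small by auto
qed

text \<open>Suppose all four corners have order at most \<open>k\<close>. If \<open>\<beta>\<close>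
  has two corners on one side of \<open>{C, D}\<close>, then \<open>\<beta>'\<close> has one on the
  other side, opposite to one of them. If \<open>\<beta>\<close> has two opposite corners,
  \<open>\<beta>'\<close> contains one of them or both of the others.\<close>

lemma uncrossing_pair:
  assumes \<beta>: "bottleneck G k \<beta>" "{A, B} \<in> \<beta>" and \<beta>': "bottleneck G k \<beta>'" "{C, D} \<in> \<beta>'"
    and cross: "crosses {A, B} {C, D}"
  shows "corner A B C D \<in> \<beta> \<and> corner B A D C \<in> \<beta>' \<or> corner B A D C \<in> \<beta> \<and> corner A B C D \<in> \<beta>' \<or>
    corner A B D C \<in> \<beta> \<and> corner B A C D \<in> \<beta>' \<or> corner B A C D \<in> \<beta> \<and> corner A B D C \<in> \<beta>' \<or>
    corner A B C D \<in> \<beta> \<and> corner B A D C \<in> \<beta> \<and> corner A B D C \<in> \<beta>' \<and> corner B A C D \<in> \<beta>' \<or>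
    corner A B D C \<in> \<beta> \<and> corner B A C D \<in> \<beta> \<and> corner A B C D \<in> \<beta>' \<and> corner B A D C \<in> \<beta>'"
proof (cases "corner_order A B C D \<le> k \<and> corner_order A B D C \<le> k \<and>
    corner_order B A C D \<le> k \<and> corner_order B A D C \<le> k")
  case True
  then show ?thesis using crossing_corners(3-6)[OF \<beta> \<beta>' cross] by blast
next
  case False
  have BA: "{B, A} = {A, B}" and DC: "{D, C} = {C, D}" by auto
  consider "corner_order A B C D > k" | "corner_order A B D C > k"
    | "corner_order B A C D > k" | "corner_order B A D C > k"
    using False by (auto simp: not_le)
  then show ?thesis
  proof cases
    case 1
    then show ?thesis using corner_exceeding[OF \<beta> \<beta>' cross] by blast
  next
    case 2
    then show ?thesis
      using corner_exceeding[of k \<beta> A B \<beta>' D C, unfolded DC, OF \<beta> \<beta>' cross] by blast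
  next
    case 3
    then show ?thesis
      using corner_exceeding[of k \<beta> B A \<beta>' C D, unfolded BA, OF \<beta> \<beta>' cross] by blast
  next
    case 4
    then show ?thesis
      using corner_exceeding[of k \<beta> B A \<beta>' D C, unfolded BA DC, OF \<beta> \<beta>' cross] by blast
  qed
qed

section \<open>Crossing numbers of bottleneck separations and their corners\<close>

lemma finite_crossing_bottleneck_seps:
  assumes "s \<in> bottleneck_seps G k"
  shows "finite {t \<in> bottleneck_seps G j. crosses s t}"
proof -
  obtain \<beta> where "bottleneck G k \<beta>" "s \<in> \<beta>"
    using assms by (auto simp: bottleneck_seps_def bottlenecks_def)
  then obtain A B where AB: "s = {A, B}" "tight_separation G {A, B}" "finite (A \<inter> B)"
    by (rule bottleneck_separation)
  have "{t \<in> bottleneck_seps G j. crosses s t} \<subseteq>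
      {t. tight_separation G t \<and> has_order t j \<and> crosses {A, B} t}"
    using AB by (auto simp: bottleneck_seps_def bottlenecks_def bottleneck_def)
  then show ?thesis
    using finite_crossing_tight_separations[OF AB(2,3)] by (rule finite_subset)
qed

lemma bottleneck_subset_seps: "bottleneck G k \<beta> \<Longrightarrow> \<beta> \<subseteq> bottleneck_seps G k"
  by (auto simp: bottleneck_seps_def bottlenecks_def)

lemma bottleneck_seps_doubleton:
  assumes "t \<in> bottleneck_seps G k"
  obtains E F where "t = {E, F}"
proof -
  obtain \<beta> where "bottleneck G k \<beta>" "t \<in> \<beta>"
    using assms by (auto simp: bottleneck_seps_def bottlenecks_def)
  then show thesis by (rule bottleneck_separation) (rule that)
qed

text \<open>A separation crossing one of the corners crosses \<open>{A, B}\<close> or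
  \<open>{C, D}\<close>, and one crossing both corners crosses both of these. The inequality is
  strict because \<open>{A, B}\<close> crosses \<open>{C, D}\<close> but neither corner.\<close>

lemma crossing_number_opposite_corners:
  assumes AB: "{A, B} \<in> bottleneck_seps G k" and CD: "{C, D} \<in> bottleneck_seps G k"
    and cross: "crosses {A, B} {C, D}"
  shows "crossing_number G k (corner A B C D) + crossing_number G k (corner B A D C)
    < crossing_number G k {A, B} + crossing_number G k {C, D}"
proof -
  define N where "N s = {t \<in> bottleneck_seps G k. crosses s t}" for s
  let ?p = "corner A B C D" and ?q = "corner B A D C"
  have finN: "finite (N {A, B})" "finite (N {C, D})"
    unfolding N_def using AB CD finite_crossing_bottleneck_seps by blast+
  have swap: "{B, A} = {A, B}" "{D, C} = {C, D}" by auto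
  have cross': "crosses {B, A} {D, C}" using cross swap by simp
  have both: "t \<in> N {A, B} \<union> N {C, D}" if "t \<in> N ?p \<union> N ?q" for t
  proof -
    have t: "t \<in> bottleneck_seps G k" "\<not> nested ?p t \<or> \<not> nested ?q t"
      using that by (auto simp: N_def crosses_def)
    obtain E F where "t = {E, F}" using t(1) by (rule bottleneck_seps_doubleton)
    with t nested_corner[OF cross, of E F] nested_corner[OF cross', of E F, unfolded swap]
    show ?thesis unfolding N_def crosses_def by blast
  qed
  have inter: "t \<in> N {A, B} \<inter> N {C, D}" if "t \<in> N ?p \<inter> N ?q" for t
  proof -
    have t: "t \<in> bottleneck_seps G k" "\<not> nested ?p t" "\<not> nested ?q t"
      using that by (auto simp: N_def crosses_def)
    obtain E F where "t = {E, F}" using t(1) by (rule bottleneck_seps_doubleton)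
    with t nested_opposite_corners[of A B E F C D] nested_opposite_corners[of C D E F A B]
    show ?thesis by (auto simp: N_def crosses_def corner_commute[of C D] corner_commute[of D C])
  qed
  have AB_notin: "{A, B} \<notin> N ?p \<union> N ?q"
    using nested_corner_left[of A B C D] nested_corner_left[of B A D C] swap
    by (auto simp: N_def crosses_def)
  have AB_in: "{A, B} \<in> N {C, D}"
    using AB cross by (auto simp: N_def crosses_def nested_commute)
  have finpq: "finite (N ?p \<union> N ?q)"
    using both finN by (intro finite_subset[of "N ?p \<union> N ?q" "N {A, B} \<union> N {C, D}"]) auto
  have "card (N ?p) + card (N ?q) = card (N ?p \<union> N ?q) + card (N ?p \<inter> N ?q)"
    using finpq by (intro card_Un_Int) auto
  also have "\<dots> < card (N {A, B} \<union> N {C, D}) + card (N {A, B} \<inter> N {C, D})"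
  proof (rule add_less_le_mono)
    show "card (N ?p \<union> N ?q) < card (N {A, B} \<union> N {C, D})"
      using finN both AB_in AB_notin by (intro psubset_card_mono) blast+
    show "card (N ?p \<inter> N ?q) \<le> card (N {A, B} \<inter> N {C, D})"
      using finN inter by (intro card_mono) auto
  qed
  also have "\<dots> = card (N {A, B}) + card (N {C, D})"
    using finN by (intro card_Un_Int[symmetric])
  finally show ?thesis by (simp add: crossing_number_def N_def)
qed

section \<open>Nestedness of the selected separations and non-emptiness of the selection\<close>

lemma N_bottleneck_least:
  assumes "s \<in> N_bottleneck G k \<beta>"
  shows "s \<in> \<beta>" and "\<And>t. t \<in> N_below G k \<Longrightarrow> nested s t"
    and "\<And>s'. s' \<in> \<beta> \<Longrightarrow> (\<And>t. t \<in> N_below G k \<Longrightarrow> nested s' t) \<Longrightarrow>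
      crossing_number G k s \<le> crossing_number G k s'"
  using assms by (auto simp: N_bottleneck_def least_crossing_def Let_def)

lemma N_below_bottleneck:
  assumes "t \<in> N_below G k"
  obtains j \<beta> where "j < k" "bottleneck G j \<beta>" "t \<in> \<beta>"
proof -
  obtain j where j: "j < k" "t \<in> N_level G j" using assms by (auto simp: N_below_def)
  then obtain \<beta> where "bottleneck G j \<beta>" "t \<in> N_bottleneck G j \<beta>"
    by (auto simp: N_level_eq bottlenecks_def)
  then show thesis using that j(1) N_bottleneck_least(1) by blast
qed

lemma N_below_doubleton:
  assumes "t \<in> N_below G k"
  obtains E F where "t = {E, F}"
proof -
  obtain j \<beta> where "bottleneck G j \<beta>" "t \<in> \<beta>"
    using assms by (rule N_below_bottleneck)
  then show thesis by (rule bottleneck_separation) (rule that)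
qed

lemma N_level_nested:
  assumes \<beta>: "bottleneck G k \<beta>" "s \<in> N_bottleneck G k \<beta>"
    and \<beta>': "bottleneck G k \<beta>'" "t \<in> N_bottleneck G k \<beta>'"
  shows "nested s t"
proof (rule ccontr)
  assume "\<not> nested s t"
  note s = N_bottleneck_least[OF \<beta>(2)] and t = N_bottleneck_least[OF \<beta>'(2)]
  obtain A B where AB: "s = {A, B}" using bottleneck_separation[OF \<beta>(1) s(1)] by metis
  obtain C D where CD: "t = {C, D}" using bottleneck_separation[OF \<beta>'(1) t(1)] by metis
  have cross: "crosses {A, B} {C, D}" using \<open>\<not> nested s t\<close> AB CD by (simp add: crosses_def)
  have swap: "{B, A} = {A, B}" "{D, C} = {C, D}" by auto
  \<comment> \<open>Corners inherit nestedness with \<open>N_below G k\<close>, so those in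
    \<open>\<beta>\<close> or \<open>\<beta>'\<close> compete with \<open>s\<close> or
    \<open>t\<close> for the least crossing number.\<close>
  have below: "nested (corner P Q R S) u"
    if PQ: "{P, Q} = {A, B}" and RS: "{R, S} = {C, D}" and u: "u \<in> N_below G k" for P Q R S u
  proof -
    obtain E F where EF: "u = {E, F}" using u by (rule N_below_doubleton)
    have "crosses {P, Q} {R, S}" "nested {P, Q} {E, F}" "nested {R, S} {E, F}"
      using s(2)[OF u] t(2)[OF u] cross unfolding PQ RS AB CD EF by simp_all
    then show ?thesis unfolding EF by (rule nested_corner)
  qed
  have ge_s: "crossing_number G k s \<le> crossing_number G k (corner P Q R S)"
    if "corner P Q R S \<in> \<beta>" "{P, Q} = {A, B}" "{R, S} = {C, D}" for P Q R S
    using s(3) below that by blast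
  have ge_t: "crossing_number G k t \<le> crossing_number G k (corner P Q R S)"
    if "corner P Q R S \<in> \<beta>'" "{P, Q} = {A, B}" "{R, S} = {C, D}" for P Q R S
    using t(3) below that by blast
  note ges = ge_s[of A B C D, OF _ refl refl] ge_s[of A B D C, OF _ refl swap(2)]
    ge_s[of B A C D, OF _ swap(1) refl] ge_s[of B A D C, OF _ swap]
    ge_t[of A B C D, OF _ refl refl] ge_t[of A B D C, OF _ refl swap(2)]
    ge_t[of B A C D, OF _ swap(1) refl] ge_t[of B A D C, OF _ swap]
  have X: "{A, B} \<in> bottleneck_seps G k" "{C, D} \<in> bottleneck_seps G k"
    using s(1) t(1) AB CD \<beta>(1) \<beta>'(1) bottleneck_subset_seps by blast+
  have sub: "crossing_number G k (corner A B C D) + crossing_number G k (corner B A D C)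
      < crossing_number G k s + crossing_number G k t"
    "crossing_number G k (corner A B D C) + crossing_number G k (corner B A C D)
      < crossing_number G k s + crossing_number G k t"
    using crossing_number_opposite_corners[of A B k C D] crossing_number_opposite_corners[of A B k D C]
      X cross AB CD swap by simp_all
  have "{A, B} \<in> \<beta>" "{C, D} \<in> \<beta>'" using s(1) t(1) AB CD by simp_all
  \<comment> \<open>If opposite corners are split between the bottlenecks, one inequality of
    \<open>sub\<close> is contradicted. In the last two cases minimality gives twice
    \<open>s\<close> against one opposite pair and twice \<open>t\<close> against the other,
    contradicting the sum of both inequalities.\<close>
  from uncrossing_pair[OF \<beta>(1) this(1) \<beta>'(1) this(2) cross]
  show False
    using ges sub by (elim disjE conjE) (simp; linarith)+
qed

text \<open>Equal levels are covered by \<open>N_level_nested\<close>; for different levels,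
  candidates for the higher one are by definition nested with all lower ones.\<close>

lemma nested_set_N_all: "nested_set (N_all G)"
proof -
  have le: "nested s t" if s: "s \<in> N_level G i" and t: "t \<in> N_level G j" and "i \<le> j" for s t i j
  proof -
    obtain \<beta> where \<beta>: "bottleneck G i \<beta>" "s \<in> N_bottleneck G i \<beta>"
      using s by (auto simp: N_level_eq bottlenecks_def)
    obtain \<beta>' where \<beta>': "bottleneck G j \<beta>'" "t \<in> N_bottleneck G j \<beta>'"
      using t by (auto simp: N_level_eq bottlenecks_def)
    show ?thesis
    proof (cases "i = j")
      case True
      then show ?thesis using N_level_nested \<beta> \<beta>' by blast
    next
      case False
      then have "s \<in> N_below G j" using s \<open>i \<le> j\<close> by (auto simp: N_below_def)
      then show ?thesis using N_bottleneck_least(2)[OF \<beta>'(2)] nested_commute by blast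
    qed
  qed
  show ?thesis
    unfolding nested_set_def N_all_def by (metis UN_iff le linear nested_commute)
qed

lemma N_below_subset_N_all: "N_below G k \<subseteq> N_all G"
  by (auto simp: N_below_def N_all_def)

text \<open>Only finitely many orders below \<open>k\<close> occur, so each element of
  \<open>\<beta>\<close> crosses finitely many elements of \<open>N_below G k\<close>. An element
  with the fewest such crossings has none, as a corner in \<open>\<beta>\<close> would do
  better.\<close>

lemma bottleneck_nested_with_N_below:
  assumes \<beta>: "bottleneck G k \<beta>"
  shows "\<exists>s\<in>\<beta>. \<forall>t\<in>N_below G k. nested s t"
proof -
  define f where "f s = {t \<in> N_below G k. crosses s t}" for s
  have fin: "finite (f s)" if "s \<in> \<beta>" for s
  proof (rule finite_subset)
    show "f s \<subseteq> (\<Union>j\<in>{..<k}. {t \<in> bottleneck_seps G j. crosses s t})"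
    proof
      fix t assume t: "t \<in> f s"
      then have "t \<in> N_below G k" by (simp add: f_def)
      then obtain j \<beta>' where "j < k" "bottleneck G j \<beta>'" "t \<in> \<beta>'"
        by (rule N_below_bottleneck)
      then show "t \<in> (\<Union>j\<in>{..<k}. {t \<in> bottleneck_seps G j. crosses s t})"
        using t bottleneck_subset_seps by (auto simp: f_def)
    qed
    show "finite (\<Union>j\<in>{..<k}. {t \<in> bottleneck_seps G j. crosses s t})"
      using finite_crossing_bottleneck_seps bottleneck_subset_seps[OF \<beta>] that by blast
  qed
  obtain s\<^sub>0 where "s\<^sub>0 \<in> \<beta>" using \<beta> by (auto simp: bottleneck_def)
  then obtain s where s: "s \<in> \<beta>" "\<And>s'. s' \<in> \<beta> \<Longrightarrow> card (f s) \<le> card (f s')"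
    using ex_has_least_nat[of "\<lambda>s. s \<in> \<beta>" s\<^sub>0 "\<lambda>s. card (f s)"] by blast
  have "f s = {}"
  proof (rule ccontr)
    assume "f s \<noteq> {}"
    then obtain t where t: "t \<in> N_below G k" "crosses s t" by (auto simp: f_def)
    obtain j \<beta>' where \<beta>': "j < k" "bottleneck G j \<beta>'" "t \<in> \<beta>'"
      using t(1) by (rule N_below_bottleneck)
    obtain A B where AB: "s = {A, B}" using bottleneck_separation[OF \<beta> s(1)] by metis
    obtain C D where CD: "t = {C, D}" using bottleneck_separation[OF \<beta>'(2,3)] by metis
    have smaller: False
      if corner: "corner P Q R S \<in> \<beta>" and PQ: "{P, Q} = s" and RS: "{R, S} = t" for P Q R S
    proof -
      have "f (corner P Q R S) \<subset> f s"
      proof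
        show "f (corner P Q R S) \<subseteq> f s"
        proof
          fix t' assume t': "t' \<in> f (corner P Q R S)"
          then have "t' \<in> N_below G k" by (simp add: f_def)
          then obtain E F where EF: "t' = {E, F}" by (rule N_below_doubleton)
          \<comment> \<open>As \<open>t'\<close> is nested with \<open>t\<close>, it can cross the
            corner only by crossing \<open>s\<close>. The crossing with \<open>t\<close> itself
            disappears, which makes the inclusion strict.\<close>
          have "nested t t'"
            using nested_set_N_all N_below_subset_N_all[of k] t(1) t' by (auto simp: nested_set_def f_def)
          then show "t' \<in> f s"
            using t' nested_corner[of P Q R S E F] EF PQ RS t(2)
            by (auto simp: f_def crosses_def)
        qed
        have "t \<in> f s" "t \<notin> f (corner P Q R S)"
          using t nested_corner_right[of P Q R S] RS by (auto simp: f_def crosses_def)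
        then show "f (corner P Q R S) \<noteq> f s" by blast
      qed
      then have "card (f (corner P Q R S)) < card (f s)"
        using fin[OF s(1)] by (rule psubset_card_mono[rotated])
      with s(2)[OF corner] show False by simp
    qed
    have eqs: "{A, B} = s" "{B, A} = s" "{C, D} = t" "{D, C} = t" using AB CD by auto
    have "corner A B C D \<in> \<beta> \<or> corner A B D C \<in> \<beta> \<or> corner B A C D \<in> \<beta> \<or> corner B A D C \<in> \<beta>"
      by (rule corner_in_higher_bottleneck[OF \<beta> s(1)[unfolded AB] \<beta>'(2) \<beta>'(3)[unfolded CD]
            t(2)[unfolded AB CD] \<beta>'(1)])
    then show False
      using smaller[OF _ eqs(1,3)] smaller[OF _ eqs(1,4)] smaller[OF _ eqs(2,3)] smaller[OF _ eqs(2,4)]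
      by blast
  qed
  with s(1) show ?thesis by (auto simp: f_def crosses_def)
qed

lemma N_bottleneck_nonempty:
  assumes "bottleneck G k \<beta>"
  shows "N_bottleneck G k \<beta> \<noteq> {}"
proof -
  obtain s where "s \<in> \<beta> \<and> (\<forall>t\<in>N_below G k. nested s t)"
    using bottleneck_nested_with_N_below[OF assms] by blast
  from ex_has_least_nat[of "\<lambda>s. s \<in> \<beta> \<and> (\<forall>t\<in>N_below G k. nested s t)", OF this, of "crossing_number G k"]
  show ?thesis unfolding N_bottleneck_def least_crossing_def Let_def by blast
qed

end

theorem theorem3p7:
  fixes G :: "'a sgraph"
  assumes "simple_graph G" and "locally_finite_graph G" and "connected_graph G"
  shows "(\<forall>k. \<forall>s \<in> bottleneck_seps G k. finite {t \<in> bottleneck_seps G k. crosses s t}) \<and>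
    nested_set (N_all G) \<and>
    (\<forall>k. nested_set (N_below G k)) \<and>
    (\<forall>k. \<forall>\<beta> \<in> bottlenecks G k. N_bottleneck G k \<beta> \<noteq> {})"
proof -
  interpret connected_locally_finite_graph G
    using assms by (rule connected_locally_finite_graph.intro)
  have "nested_set (N_below G k)" for k
    using nested_set_N_all N_below_subset_N_all[of k] by (auto simp: nested_set_def)
  then show ?thesis
    using finite_crossing_bottleneck_seps nested_set_N_all N_bottleneck_nonempty
    by (simp add: bottlenecks_def)
qed

end
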